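(* Let $n\geq3$. (1) For any $x\in\mathbb{B}^{n}\setminus\{0\}$ and $l\in\mathbb{S}^{n-1}$, $$\mathbf{C}_{\mathbb{B}^{n},\infty}(x;l)\leq\mathbf{C}_{\mathbb{B}^{n},\infty}\big(x;\pm\tfrac{x}{|x|}\big)=\mathbf{C}_{\mathbb{B}^{n},\infty}(x)=2(n-1)\frac{(1+|x|)^{n-2}}{(1-|x|)^{n}}.$$ (2) For any $x\in\mathbb{H}^{n}$ and $l\in\mathbb{S}^{n-1}$, $$\mathbf{C}_{\mathbb{H}^{n},\infty}(x;l)\leq\mathbf{C}_{\mathbb{H}^{n},\infty}(x;\pm e_{n})=\mathbf{C}_{\mathbb{H}^{n},\infty}(x)=\frac{2^{n-2}(n-1)\Gamma(\frac{n}{2})}{\pi^{\frac{n}{2}}x_{n}^{n}}.$$ Here $\pm$ means the statement holds for both choices of sign.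
   Context: $\langle\cdot,\cdot\rangle$ and $|\cdot|$ are the Euclidean inner product and norm on $\mathbb{R}^n$; $\mathbb{B}^n=\{|x|<1\}$, $\mathbb{S}^{n-1}=\{|x|=1\}$, $\mathbb{H}^n=\{x=(x',x_n): x'\in\mathbb{R}^{n-1},\,x_n>0\}$, $e_n=(0,\ldots,0,1)$; $\partial\mathbb{H}^n$ is identified with $\mathbb{R}^{n-1}$. $\Gamma$ is the Gamma function. $\sigma$ is the surface measure on $\mathbb{S}^{n-1}$ normalized so that $\sigma(\mathbb{S}^{n-1})=1$, and $V_{n-1}$ is Lebesgue measure on $\mathbb{R}^{n-1}$; $L^1(\mathbb{S}^{n-1},\mathbb{R})$ and $L^1(\mathbb{R}^{n-1},\mathbb{R})$ are taken with respect to these. Poisson–Szegő integrals (for the hyperbolic Laplacian): $$\mathcal{P}_{\mathbb{B}^n}[\phi](x)=\int_{\mathbb{S}^{n-1}}\Big(\frac{1-|x|^2}{|x-\zeta|^2}\Big)^{n-1}\phi(\zeta)\,d\sigma(\zeta),\quad x\in\mathbb{B}^n,$$ $$\mathcal{P}_{\mathbb{H}^n}[\phi](x)=c_n\int_{\mathbb{R}^{n-1}}\Big(\frac{x_n}{|x'-y'|^2+x_n^2}\Big)^{n-1}\phi(y')\,dV_{n-1}(y'),\quad x\in\mathbb{H}^n,\qquad c_n=\frac{2^{n-2}\Gamma(n/2)}{\pi^{n/2}}.$$ For $\Omega=\mathbb{B}^n$ or $\mathbb{H}^n$, $x\in\Omega$ and $l\in\mathbb{S}^{n-1}$, $\mathbf{C}_{\Omega,\infty}(x)$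 and $\mathbf{C}_{\Omega,\infty}(x;l)$ denote the smallest constants such that $$|\nabla u(x)|\leq \mathbf{C}_{\Omega,\infty}(x)\|\phi\|_{L^1(\partial\Omega,\mathbb{R})},\qquad |\langle\nabla u(x),l\rangle|\leq \mathbf{C}_{\Omega,\infty}(x;l)\|\phi\|_{L^1(\partial\Omega,\mathbb{R})}$$ hold for all $\phi\in L^1(\partial\Omega,\mathbb{R})$ with $u=\mathcal{P}_\Omega[\phi]$ (the index $\infty$ is the exponent conjugate to $1$). *)

theory Defs
  imports "HOL-Analysis.Analysis"
begin

definition gradient :: "('a::real_inner \<Rightarrow> real) \<Rightarrow> 'a \<Rightarrow> 'a" where
  "gradient u x = (THE D. GDERIV u x :> D)"

text \<open>
  The normalized surface measure on the unit sphere, as the measure of polar coordinates: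
  the measure of a Borel set \<open>A\<close> of the sphere is the volume of the part of the unit ball that
  projects radially into \<open>A\<close> (the cone over \<open>A\<close>), divided by the volume of the unit ball.
\<close>

definition sphere_measure :: "'a::euclidean_space measure" where
  "sphere_measure =
     restrict_space
       (distr (uniform_measure lborel (ball 0 1)) borel (\<lambda>x. x /\<^sub>R norm x))
       (sphere 0 1)"

definition poisson_ball :: "(real^'n \<Rightarrow> real) \<Rightarrow> real^'n \<Rightarrow> real" where
  "poisson_ball \<phi> x =
     (LINT \<zeta>|sphere_measure. ((1 - (norm x)\<^sup>2) / (norm (x - \<zeta>))\<^sup>2) ^ (CARD('n) - 1) * \<phi> \<zeta>)"

text \<open>
  For the half-space, \<open>\<real>\<^sup>n\<close> is \<open>\<real>\<^sup>n\<^sup>-\<^sup>1 \<times> \<real>\<close>, with \<open>n - 1\<close> the cardinality of the index type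
  \<open>'m\<close>; the norm and inner product of the product type are the Euclidean ones.
\<close>

definition half_space :: "((real^'m) \<times> real) set" where
  "half_space = {x. snd x > 0}"

definition half_space_const :: "nat \<Rightarrow> real" where
  "half_space_const n = 2 ^ (n - 2) * Gamma (real n / 2) / pi powr (real n / 2)"

definition poisson_half_space :: "(real^'m \<Rightarrow> real) \<Rightarrow> (real^'m) \<times> real \<Rightarrow> real" where
  "poisson_half_space \<phi> x =
     half_space_const (CARD('m) + 1) *
     (LINT y|lebesgue. (snd x / ((norm (fst x - y))\<^sup>2 + (snd x)\<^sup>2)) ^ CARD('m) * \<phi> y)"

text \<open>
  The smallest constants in the gradient estimates for the integral operator \<open>P\<close> acting on
  \<open>L\<^sup>1\<close> of the boundary measure \<open>M\<close>.  If no smallest constant exists, \<open>LEAST\<close> is an unspecified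
  real number, so no equation or bound for it is provable in that case.
\<close>

definition grad_const ::
    "'b measure \<Rightarrow> (('b \<Rightarrow> real) \<Rightarrow> 'a::real_inner \<Rightarrow> real) \<Rightarrow> 'a \<Rightarrow> real" where
  "grad_const M P x =
     (LEAST C. \<forall>\<phi>. integrable M \<phi> \<longrightarrow> norm (gradient (P \<phi>) x) \<le> C * (LINT \<zeta>|M. \<bar>\<phi> \<zeta>\<bar>))"

definition dir_grad_const ::
    "'b measure \<Rightarrow> (('b \<Rightarrow> real) \<Rightarrow> 'a::real_inner \<Rightarrow> real) \<Rightarrow> 'a \<Rightarrow> 'a \<Rightarrow> real" where
  "dir_grad_const M P x l =
     (LEAST C. \<forall>\<phi>. integrable M \<phi> \<longrightarrow> \<bar>gradient (P \<phi>) x \<bullet> l\<bar> \<le> C * (LINT \<zeta>|M. \<bar>\<phi> \<zeta>\<bar>))"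

abbreviation C_ball :: "real^'n \<Rightarrow> real" where
  "C_ball \<equiv> grad_const sphere_measure poisson_ball"

abbreviation C_ball_dir :: "real^'n \<Rightarrow> real^'n \<Rightarrow> real" where
  "C_ball_dir \<equiv> dir_grad_const sphere_measure poisson_ball"

abbreviation C_half_space :: "(real^'m) \<times> real \<Rightarrow> real" where
  "C_half_space \<equiv> grad_const lebesgue poisson_half_space"

abbreviation C_half_space_dir :: "(real^'m) \<times> real \<Rightarrow> (real^'m) \<times> real \<Rightarrow> real" where
  "C_half_space_dir \<equiv> dir_grad_const lebesgue poisson_half_space"

end

theory Submission imports Defs begin

text \<open>
  If \<open>g\<close> is the gradient at \<open>x\<close> of the kernel of \<open>P\<close>, then \<open>\<nabla>P[\<phi>](x) = \<integral> \<phi> g\<close>, so the sharp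
  constants are at most \<open>sup |g|\<close>. For both Poisson-Szego kernels \<open>q ^ (n - 1)\<close> the base \<open>q\<close> has a
  gradient of a simple length, \<open>2 / |x - \<zeta>|\<^sup>2\<close> for the ball and \<open>1 / (|x' - y'|\<^sup>2 + x\<^sub>n\<^sup>2)\<close> for the
  half-space. Hence \<open>|g|\<close> is maximal at the boundary point nearest to \<open>x\<close>, where \<open>g\<close> is parallel
  to \<open>x\<close>, respectively \<open>e\<^sub>n\<close>. Concentrating \<open>\<phi>\<close> near that point shows that this maximum is
  attained in this direction, by the directional constant as well as by the full one.
\<close>

section \<open>Gradients of integral operators\<close>

lemma gradient_eqI: "GDERIV u x :> D \<Longrightarrow> gradient u x = D"
  unfolding gradient_def gderiv_def
  by (rule the_equality, assumption)
    (metis (no_types, lifting) has_derivative_unique inner_commute vector_eq_ldot)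

lemma GDERIV_const_power:
  assumes "GDERIV q x :> D"
  shows "GDERIV (\<lambda>y. c * q y ^ k) x :> (c * (real k * q x ^ (k - 1))) *\<^sub>R D"
proof -
  have "DERIV (\<lambda>t. c * t ^ k) (q x) :> c * (real k * q x ^ (k - 1))"
    by (auto intro!: derivative_eq_intros)
  from GDERIV_DERIV_compose[OF assms this] show ?thesis .
qed

text \<open>Mean value inequality, available because a ball is convex. It dominates the difference
  quotients when differentiating under the integral.\<close>

lemma GDERIV_imp_lipschitz_on_ball:
  fixes f :: "'a::real_inner \<Rightarrow> real"
  assumes f: "\<And>y. y \<in> ball x r \<Longrightarrow> GDERIV f y :> D y"
    and B: "\<And>y. y \<in> ball x r \<Longrightarrow> norm (D y) \<le> B"
    and "y \<in> ball x r" "z \<in> ball x r"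
  shows "\<bar>f y - f z\<bar> \<le> B * norm (y - z)"
proof -
  have "norm (f y - f z) \<le> B * norm (y - z)"
  proof (rule differentiable_bound[where S="ball x r" and f'="\<lambda>y h. h \<bullet> D y"])
    show "onorm (\<lambda>h. h \<bullet> D y) \<le> B" if "y \<in> ball x r" for y
    proof (rule onorm_bound)
      show "0 \<le> B" using B[OF that] norm_ge_zero order_trans by blast
      show "norm (h \<bullet> D y) \<le> B * norm h" for h
        using Cauchy_Schwarz_ineq2[of h "D y"] mult_left_mono[OF B[OF that] norm_ge_zero[of h]]
        by (simp add: mult.commute)
    qed
  qed (use assms in \<open>auto simp: gderiv_def intro: has_derivative_at_withinI\<close>)
  then show ?thesis by simp
qed

lemma integrable_scaleR_bounded:
  fixes g :: "'b \<Rightarrow> 'a::euclidean_space"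
  assumes "integrable M \<phi>" and [measurable]: "g \<in> borel_measurable M"
    and B: "\<And>\<zeta>. \<zeta> \<in> space M \<Longrightarrow> norm (g \<zeta>) \<le> B"
  shows "integrable M (\<lambda>\<zeta>. \<phi> \<zeta> *\<^sub>R g \<zeta>)"
proof (rule Bochner_Integration.integrable_bound[of _ "\<lambda>\<zeta>. B * \<phi> \<zeta>"])
  show "AE \<zeta> in M. norm (\<phi> \<zeta> *\<^sub>R g \<zeta>) \<le> norm (B * \<phi> \<zeta>)"
  proof (rule AE_I2)
    fix \<zeta> assume "\<zeta> \<in> space M"
    from B[OF this] have "norm (g \<zeta>) \<le> \<bar>B\<bar>" by linarith
    then show "norm (\<phi> \<zeta> *\<^sub>R g \<zeta>) \<le> norm (B * \<phi> \<zeta>)"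
      using mult_right_mono[of "norm (g \<zeta>)" "\<bar>B\<bar>" "\<bar>\<phi> \<zeta>\<bar>"] by (simp add: abs_mult mult.commute)
  qed
qed (use assms in auto)

text \<open>Dominated convergence for the normalized first-order remainders of \<open>K\<close>:
  they tend to 0 pointwise, and the uniform gradient bound \<open>B\<close> times
  \<open>\<bar>\<phi> \<zeta>\<bar>\<close> yields an integrable majorant. The bound
  \<open>A\<close> makes \<open>K y \<zeta> * \<phi> \<zeta>\<close> integrable for each
  \<open>y\<close> in the ball.\<close>

lemma GDERIV_integral:
  fixes K :: "'a::euclidean_space \<Rightarrow> 'b \<Rightarrow> real" and G :: "'a \<Rightarrow> 'b \<Rightarrow> 'a"
  assumes "r > 0"
    and K: "\<And>y \<zeta>. y \<in> ball x r \<Longrightarrow> \<zeta> \<in> space M \<Longrightarrow> GDERIV (\<lambda>y. K y \<zeta>) y :> G y \<zeta>"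
    and B: "\<And>y \<zeta>. y \<in> ball x r \<Longrightarrow> \<zeta> \<in> space M \<Longrightarrow> norm (G y \<zeta>) \<le> B"
    and A: "\<And>y \<zeta>. y \<in> ball x r \<Longrightarrow> \<zeta> \<in> space M \<Longrightarrow> \<bar>K y \<zeta>\<bar> \<le> A"
    and meas_K: "\<And>y. K y \<in> borel_measurable M" and meas_G: "G x \<in> borel_measurable M"
    and int: "integrable M \<phi>"
  shows "GDERIV (\<lambda>y. LINT \<zeta>|M. K y \<zeta> * \<phi> \<zeta>) x :> (LINT \<zeta>|M. \<phi> \<zeta> *\<^sub>R G x \<zeta>)"
proof -
  note [measurable] = meas_K meas_G borel_measurable_integrable[OF int]
  have x: "x \<in> ball x r" using \<open>r > 0\<close> by simp
  have int_K: "integrable M (\<lambda>\<zeta>. K y \<zeta> * \<phi> \<zeta>)" if "y \<in> ball x r" for y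
    using integrable_scaleR_bounded[OF int meas_K, of y A] A[OF that] by (simp add: mult.commute)
  have int_G: "integrable M (\<lambda>\<zeta>. \<phi> \<zeta> *\<^sub>R G x \<zeta>)"
    using B[OF x] by (rule integrable_scaleR_bounded[OF int meas_G])
  define F where "F = (\<lambda>y. LINT \<zeta>|M. K y \<zeta> * \<phi> \<zeta>)"
  define D where "D = (LINT \<zeta>|M. \<phi> \<zeta> *\<^sub>R G x \<zeta>)"
  \<comment> \<open>Differentiability of \<open>F\<close> at \<open>x\<close> with gradient
    \<open>D\<close> says exactly that the integral of \<open>R y \<zeta> * \<phi> \<zeta>\<close>
    tends to 0 as \<open>y\<close> tends to \<open>x\<close>.\<close>
  define R where "R = (\<lambda>y \<zeta>. (K y \<zeta> - K x \<zeta> - (y - x) \<bullet> G x \<zeta>) /\<^sub>R norm (y - x))"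
  have R_eq: "(F y - F x - (y - x) \<bullet> D) /\<^sub>R norm (y - x) = (LINT \<zeta>|M. R y \<zeta> * \<phi> \<zeta>)"
    if y: "y \<in> ball x r" for y
  proof -
    have "(LINT \<zeta>|M. R y \<zeta> * \<phi> \<zeta>) =
        (LINT \<zeta>|M. (K y \<zeta> * \<phi> \<zeta> - K x \<zeta> * \<phi> \<zeta> - (y - x) \<bullet> (\<phi> \<zeta> *\<^sub>R G x \<zeta>)) /\<^sub>R norm (y - x))"
      unfolding R_def by (intro Bochner_Integration.integral_cong) (auto simp: algebra_simps)
    also have "\<dots> = (F y - F x - (y - x) \<bullet> D) /\<^sub>R norm (y - x)"
      unfolding F_def D_def using int_K[OF y] int_K[OF x] int_G
      by (simp add: Bochner_Integration.integral_diff integral_inner_right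
          integrable_inner_right del: inner_scaleR_right)
    finally show ?thesis ..
  qed
  \<comment> \<open>One \<open>B\<close> comes from the mean value inequality for \<open>K\<close>,
    the other from Cauchy-Schwarz for the linear term.\<close>
  have R_bound: "\<bar>R y \<zeta>\<bar> \<le> 2 * B" if y: "y \<in> ball x r" "y \<noteq> x" and \<zeta>: "\<zeta> \<in> space M" for y \<zeta>
  proof -
    have "\<bar>K y \<zeta> - K x \<zeta>\<bar> \<le> B * norm (y - x)"
      by (rule GDERIV_imp_lipschitz_on_ball[where f="\<lambda>y. K y \<zeta>" and D="\<lambda>y. G y \<zeta>"])
        (use K B \<zeta> y x in auto)
    moreover have "\<bar>(y - x) \<bullet> G x \<zeta>\<bar> \<le> norm (y - x) * norm (G x \<zeta>)"
      by (rule Cauchy_Schwarz_ineq2)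
    moreover have "norm (y - x) * norm (G x \<zeta>) \<le> B * norm (y - x)"
      using mult_left_mono[OF B[OF x \<zeta>] norm_ge_zero[of "y - x"]] by (simp add: mult.commute)
    ultimately have "\<bar>K y \<zeta> - K x \<zeta> - (y - x) \<bullet> G x \<zeta>\<bar> \<le> 2 * B * norm (y - x)"
      by linarith
    then show ?thesis
      using y by (simp add: R_def abs_mult field_simps)
  qed
  have R_lim: "((\<lambda>y. R y \<zeta>) \<longlongrightarrow> 0) (at x)" if "\<zeta> \<in> space M" for \<zeta>
    using K[OF x that] unfolding gderiv_def has_derivative_at_within R_def by simp
  have "((\<lambda>y. LINT \<zeta>|M. R y \<zeta> * \<phi> \<zeta>) \<longlongrightarrow> 0) (at x within ball x r)"
    \<comment> \<open>Dominated convergence concerns sequences, so the limit is tested along all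
      sequences in the ball that avoid \<open>x\<close>.\<close>
    unfolding tendsto_at_iff_sequentially
  proof (intro allI impI)
    fix X assume X: "\<forall>i. X i \<in> ball x r - {x}" "X \<longlonglongrightarrow> x"
    have lim: "(\<lambda>i. R (X i) \<zeta> * \<phi> \<zeta>) \<longlonglongrightarrow> 0" if "\<zeta> \<in> space M" for \<zeta>
    proof -
      have "(\<lambda>i. R (X i) \<zeta>) \<longlonglongrightarrow> 0"
        by (rule filterlim_compose[OF R_lim[OF that]]) (use X in \<open>auto simp: filterlim_at\<close>)
      then show ?thesis by (rule tendsto_mult_left_zero)
    qed
    have "(\<lambda>i. LINT \<zeta>|M. R (X i) \<zeta> * \<phi> \<zeta>) \<longlonglongrightarrow> (LINT \<zeta>|M. 0)"
    proof (rule integral_dominated_convergence[where w="\<lambda>\<zeta>. 2 * B * \<bar>\<phi> \<zeta>\<bar>"])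
      show "AE \<zeta> in M. (\<lambda>i. R (X i) \<zeta> * \<phi> \<zeta>) \<longlonglongrightarrow> 0" using lim by auto
      show "AE \<zeta> in M. norm (R (X i) \<zeta> * \<phi> \<zeta>) \<le> 2 * B * \<bar>\<phi> \<zeta>\<bar>" for i
        using R_bound X by (auto simp: abs_mult intro!: AE_I2 mult_right_mono)
      show "(\<lambda>\<zeta>. R (X i) \<zeta> * \<phi> \<zeta>) \<in> borel_measurable M" for i
        unfolding R_def by measurable
    qed (use int in auto)
    then show "((\<lambda>y. LINT \<zeta>|M. R y \<zeta> * \<phi> \<zeta>) \<circ> X) \<longlonglongrightarrow> 0" by (simp add: comp_def)
  qed
  then have "((\<lambda>y. (F y - F x - (y - x) \<bullet> D) /\<^sub>R norm (y - x)) \<longlongrightarrow> 0) (at x within ball x r)"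
    by (rule Lim_transform_eventually)
      (use R_eq in \<open>auto simp: eventually_at_filter\<close>)
  then have "(F has_derivative (\<lambda>h. h \<bullet> D)) (at x within ball x r)"
    unfolding has_derivative_at_within by (simp add: bounded_linear_inner_left)
  then show ?thesis
    unfolding gderiv_def F_def D_def using at_within_open[OF x] by simp
qed

section \<open>Sharp constants of an operator with a bounded gradient kernel\<close>

text \<open>The admissible constants form a closed set, bounded below by the quotient
  \<open>N \<phi> / b \<phi>\<close> of a single \<open>\<phi>\<close> with
  \<open>b \<phi> > 0\<close>. Hence their infimum is admissible and \<open>LEAST\<close> is a
  genuine minimum.\<close>

lemma Least_constant_le:
  fixes N b :: "'c \<Rightarrow> real"
  assumes A: "\<And>\<phi>. Q \<phi> \<Longrightarrow> N \<phi> \<le> A * b \<phi>"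
    and \<phi>: "Q \<phi>" "b \<phi> > 0"
  shows "(LEAST C. \<forall>\<phi>. Q \<phi> \<longrightarrow> N \<phi> \<le> C * b \<phi>) \<le> A"
proof -
  let ?S = "{C. \<forall>\<phi>. Q \<phi> \<longrightarrow> N \<phi> \<le> C * b \<phi>}"
  have bdd: "bdd_below ?S"
  proof (rule bdd_belowI)
    fix C assume "C \<in> ?S"
    then show "N \<phi> / b \<phi> \<le> C" using \<phi> by (simp add: pos_divide_le_eq)
  qed
  have "closed ?S"
    by (intro closed_Collect_all closed_Collect_imp closed_Collect_le continuous_intros) simp
  moreover have A: "A \<in> ?S" using A by simp
  ultimately have "Inf ?S \<in> ?S"
    using closed_contains_Inf[of ?S] bdd by blast
  then have "(LEAST C. \<forall>\<phi>. Q \<phi> \<longrightarrow> N \<phi> \<le> C * b \<phi>) = Inf ?S"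
    by (intro Least_equality) (auto intro: cInf_lower[OF _ bdd])
  with cInf_lower[OF A bdd] show ?thesis by simp
qed

text \<open>Common setting for both domains. \<open>near_extremal\<close> asks for \<open>g\<close>
  to be close to \<open>A *\<^sub>R e\<close> on a set of positive finite measure, not merely to
  equal it at one point, since points may be null sets. With \<open>norm_g\<close> it makes
  \<open>A\<close> the essential supremum of the length of \<open>g\<close>.\<close>

locale gradient_kernel =
  fixes M :: "'b measure" and P :: "('b \<Rightarrow> real) \<Rightarrow> 'a::euclidean_space \<Rightarrow> real"
    and x :: 'a and g :: "'b \<Rightarrow> 'a" and A :: real and e :: 'a
  assumes gderiv: "\<And>\<phi>. integrable M \<phi> \<Longrightarrow> GDERIV (P \<phi>) x :> (LINT \<zeta>|M. \<phi> \<zeta> *\<^sub>R g \<zeta>)"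
    and measurable_g [measurable]: "g \<in> borel_measurable M"
    and norm_g: "\<And>\<zeta>. \<zeta> \<in> space M \<Longrightarrow> norm (g \<zeta>) \<le> A"
    and norm_e: "norm e = 1"
    and near_extremal: "\<And>\<epsilon>. \<epsilon> > 0 \<Longrightarrow> \<exists>U\<in>sets M. emeasure M U \<noteq> 0 \<and> emeasure M U \<noteq> \<infinity> \<and>
      (\<forall>\<zeta>\<in>U. norm (g \<zeta> - A *\<^sub>R e) \<le> \<epsilon>)"
begin

lemma integrable_scaleR_g: "integrable M \<phi> \<Longrightarrow> integrable M (\<lambda>\<zeta>. \<phi> \<zeta> *\<^sub>R g \<zeta>)"
  by (rule integrable_scaleR_bounded[OF _ measurable_g norm_g])

lemma norm_gradient_le:
  assumes "integrable M \<phi>"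
  shows "norm (gradient (P \<phi>) x) \<le> A * (LINT \<zeta>|M. \<bar>\<phi> \<zeta>\<bar>)"
proof -
  have "norm (LINT \<zeta>|M. \<phi> \<zeta> *\<^sub>R g \<zeta>) \<le> (LINT \<zeta>|M. norm (\<phi> \<zeta> *\<^sub>R g \<zeta>))"
    by (rule integral_norm_bound)
  also have "\<dots> \<le> (LINT \<zeta>|M. A * \<bar>\<phi> \<zeta>\<bar>)"
  proof (rule integral_mono)
    show "norm (\<phi> \<zeta> *\<^sub>R g \<zeta>) \<le> A * \<bar>\<phi> \<zeta>\<bar>" if "\<zeta> \<in> space M" for \<zeta>
      using mult_left_mono[OF norm_g[OF that], of "\<bar>\<phi> \<zeta>\<bar>"] by (simp add: mult.commute)
  qed (use integrable_norm[OF integrable_scaleR_g[OF assms]] assms in auto)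
  finally show ?thesis using gradient_eqI[OF gderiv[OF assms]] by simp
qed

lemma abs_gradient_inner_le:
  assumes "integrable M \<phi>" "norm l = 1"
  shows "\<bar>gradient (P \<phi>) x \<bullet> l\<bar> \<le> A * (LINT \<zeta>|M. \<bar>\<phi> \<zeta>\<bar>)"
  using Cauchy_Schwarz_ineq2[of "gradient (P \<phi>) x" l] norm_gradient_le[OF assms(1)] assms(2)
  by simp

text \<open>The indicator of a set from \<open>near_extremal\<close> works: on that set the
  component of \<open>g\<close> along \<open>e\<close> is at least \<open>A - \<epsilon>\<close>, by
  Cauchy-Schwarz.\<close>

lemma obtain_test_function:
  assumes "\<epsilon> > 0"
  obtains \<phi> where "integrable M \<phi>" "0 < (LINT \<zeta>|M. \<bar>\<phi> \<zeta>\<bar>)"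
    "(A - \<epsilon>) * (LINT \<zeta>|M. \<bar>\<phi> \<zeta>\<bar>) \<le> \<bar>gradient (P \<phi>) x \<bullet> e\<bar>"
proof -
  obtain U where [measurable]: "U \<in> sets M" and U: "emeasure M U \<noteq> 0" "emeasure M U \<noteq> \<infinity>"
    "\<And>\<zeta>. \<zeta> \<in> U \<Longrightarrow> norm (g \<zeta> - A *\<^sub>R e) \<le> \<epsilon>"
    using near_extremal[OF assms] by blast
  define \<phi> :: "'b \<Rightarrow> real" where "\<phi> = indicator U"
  have \<phi>: "integrable M \<phi>" unfolding \<phi>_def using U by (simp add: top.not_eq_extremum)
  have abs: "(\<lambda>\<zeta>. \<bar>\<phi> \<zeta>\<bar>) = \<phi>" by (auto simp: \<phi>_def)
  have int: "(LINT \<zeta>|M. \<phi> \<zeta>) = measure M U" by (simp add: \<phi>_def)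
  have pos: "measure M U > 0" using U by (simp add: measure_def enn2real_positive_iff top.not_eq_extremum zero_less_iff_neq_zero)
  have "(A - \<epsilon>) * (LINT \<zeta>|M. \<phi> \<zeta>) = (LINT \<zeta>|M. (A - \<epsilon>) * \<phi> \<zeta>)" by simp
  also have "\<dots> \<le> (LINT \<zeta>|M. (\<phi> \<zeta> *\<^sub>R g \<zeta>) \<bullet> e)"
  proof (rule integral_mono)
    fix \<zeta>
    have "A - \<epsilon> \<le> g \<zeta> \<bullet> e" if "\<zeta> \<in> U"
    proof -
      have "\<bar>(g \<zeta> - A *\<^sub>R e) \<bullet> e\<bar> \<le> \<epsilon>"
        using Cauchy_Schwarz_ineq2[of "g \<zeta> - A *\<^sub>R e" e] U(3)[OF that] norm_e by simp
      then show ?thesis using norm_e by (simp add: inner_diff_left norm_eq_1)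
    qed
    then show "(A - \<epsilon>) * \<phi> \<zeta> \<le> (\<phi> \<zeta> *\<^sub>R g \<zeta>) \<bullet> e" by (simp add: \<phi>_def indicator_def)
  qed (use \<phi> integrable_inner_left[OF integrable_scaleR_g[OF \<phi>]] in auto)
  also have "\<dots> = (LINT \<zeta>|M. \<phi> \<zeta> *\<^sub>R g \<zeta>) \<bullet> e"
    by (rule integral_inner_left) (use integrable_scaleR_g[OF \<phi>] in auto)
  also have "\<dots> = gradient (P \<phi>) x \<bullet> e" using gradient_eqI[OF gderiv[OF \<phi>]] by simp
  finally show thesis
    using that[OF \<phi>] pos int unfolding abs by linarith
qed

lemma dir_grad_const_le:
  assumes "norm l = 1" shows "dir_grad_const M P x l \<le> A"
proof -
  \<comment> \<open>A function of positive norm ensures that the smallest constant exists; the value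
    1 of \<open>\<epsilon>\<close> is arbitrary.\<close>
  obtain \<phi> :: "'b \<Rightarrow> real" where "integrable M \<phi>" "0 < (LINT \<zeta>|M. \<bar>\<phi> \<zeta>\<bar>)" using obtain_test_function[of 1] by auto
  then show ?thesis unfolding dir_grad_const_def
    by (intro Least_constant_le[where \<phi>=\<phi>] abs_gradient_inner_le assms)
qed

text \<open>Test functions lose at most \<open>\<epsilon>\<close>, which is arbitrary. Only the
  estimate along \<open>e\<close> is assumed, so minimality of \<open>A\<close> follows for the
  directional and the full constant alike.\<close>

lemma constant_ge:
  assumes "\<And>\<phi>. integrable M \<phi> \<Longrightarrow> \<bar>gradient (P \<phi>) x \<bullet> e\<bar> \<le> C * (LINT \<zeta>|M. \<bar>\<phi> \<zeta>\<bar>)"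
  shows "A \<le> C"
proof (rule field_le_epsilon)
  fix \<epsilon> :: real assume "\<epsilon> > 0"
  then obtain \<phi> :: "'b \<Rightarrow> real" where \<phi>: "integrable M \<phi>" "0 < (LINT \<zeta>|M. \<bar>\<phi> \<zeta>\<bar>)"
    "(A - \<epsilon>) * (LINT \<zeta>|M. \<bar>\<phi> \<zeta>\<bar>) \<le> \<bar>gradient (P \<phi>) x \<bullet> e\<bar>"
    by (rule obtain_test_function)
  from \<phi>(3) assms[OF \<phi>(1)] have "(A - \<epsilon>) * (LINT \<zeta>|M. \<bar>\<phi> \<zeta>\<bar>) \<le> C * (LINT \<zeta>|M. \<bar>\<phi> \<zeta>\<bar>)"
    by (rule order_trans)
  with \<phi>(2) show "A \<le> C + \<epsilon>" by simp
qed

lemma dir_grad_const_extremal: "dir_grad_const M P x e = A"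
  unfolding dir_grad_const_def
  by (rule Least_equality) (use abs_gradient_inner_le[OF _ norm_e] constant_ge in auto)

lemma grad_const_eq: "grad_const M P x = A"
  unfolding grad_const_def
proof (rule Least_equality)
  fix C assume C: "\<forall>\<phi>. integrable M \<phi> \<longrightarrow> norm (gradient (P \<phi>) x) \<le> C * (LINT \<zeta>|M. \<bar>\<phi> \<zeta>\<bar>)"
  \<comment> \<open>A constant that bounds the whole gradient also bounds its component along the
    unit vector \<open>e\<close>.\<close>
  show "A \<le> C"
  proof (rule constant_ge)
    fix \<phi> :: "'b \<Rightarrow> real" assume "integrable M \<phi>"
    with C have "norm (gradient (P \<phi>) x) \<le> C * (LINT \<zeta>|M. \<bar>\<phi> \<zeta>\<bar>)" by blast
    then show "\<bar>gradient (P \<phi>) x \<bullet> e\<bar> \<le> C * (LINT \<zeta>|M. \<bar>\<phi> \<zeta>\<bar>)"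
      using Cauchy_Schwarz_ineq2[of "gradient (P \<phi>) x" e] norm_e by simp
  qed
qed (use norm_gradient_le in auto)

lemma extremal:
  assumes "norm l = 1" and "s \<in> {1, - 1}"
  shows "dir_grad_const M P x l \<le> dir_grad_const M P x (s *\<^sub>R e) \<and>
    dir_grad_const M P x (s *\<^sub>R e) = grad_const M P x \<and> grad_const M P x = A"
proof -
  \<comment> \<open>The sign \<open>s\<close> disappears in the absolute value of the inner
    product.\<close>
  have "dir_grad_const M P x (s *\<^sub>R e) = dir_grad_const M P x e"
    using assms(2) by (auto simp: dir_grad_const_def)
  then show ?thesis
    using dir_grad_const_le[OF assms(1)] dir_grad_const_extremal grad_const_eq by simp
qed

end

section \<open>The ball\<close>

lemma emeasure_lebesgue_open_neq_0:
  fixes S :: "'a::euclidean_space set"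
  assumes "open S" "S \<noteq> {}"
  shows "emeasure lebesgue S \<noteq> 0"
  using open_not_negligible[OF assms] assms(1) negligible_iff_emeasure0[of S] by auto

text \<open>The cone over a cap contains a nonempty open part of the unit ball, hence has positive
  volume. Caps around the boundary point nearest to \<open>x\<close> will witness
  \<open>near_extremal\<close>.\<close>

lemma sphere_measure_cap:
  fixes \<zeta>\<^sub>0 :: "'a::euclidean_space"
  assumes "\<zeta>\<^sub>0 \<in> sphere 0 1" "\<delta> > 0"
  defines "U \<equiv> sphere 0 1 \<inter> ball \<zeta>\<^sub>0 \<delta>"
  shows "U \<in> sets sphere_measure" "emeasure sphere_measure U \<noteq> 0" "emeasure sphere_measure U \<noteq> \<infinity>"
proof -
  let ?f = "\<lambda>x::'a. x /\<^sub>R norm x"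
  have U: "U \<in> sets borel" unfolding U_def by simp
  then show "U \<in> sets sphere_measure"
    unfolding sphere_measure_def by (auto simp: sets_restrict_space U_def)
  have V: "?f -` U \<in> sets borel"
    using measurable_sets[of ?f borel borel U] U by simp
  have eq: "emeasure sphere_measure U =
      emeasure lborel (ball 0 1 \<inter> ?f -` U) / emeasure lborel (ball (0::'a) 1)"
    unfolding sphere_measure_def using U V
    by (subst emeasure_restrict_space) (auto simp: emeasure_distr U_def)
  have ball: "emeasure lborel (ball (0::'a) 1) \<noteq> \<infinity>" "emeasure lborel (ball (0::'a) 1) \<noteq> 0"
    using emeasure_bounded_finite[of "ball (0::'a) 1"] emeasure_lebesgue_open_neq_0[of "ball (0::'a) 1"]
    by auto
  have "emeasure lborel (ball 0 1 \<inter> ?f -` U) \<le> emeasure lborel (ball (0::'a) 1)"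
    by (rule emeasure_mono) auto
  with ball show "emeasure sphere_measure U \<noteq> \<infinity>"
    unfolding eq by (auto simp: ennreal_divide_eq_top_iff top_unique)
  \<comment> \<open>The origin is removed because the radial projection is continuous only away from
    it. On \<open>W\<close> the projection has unit length, so it lands in \<open>U\<close>.\<close>
  define W where "W = (ball 0 1 - {0}) \<inter> ?f -` ball \<zeta>\<^sub>0 \<delta>"
  have "open W" unfolding W_def
    by (intro continuous_open_preimage continuous_intros) auto
  moreover have "(1/2) *\<^sub>R \<zeta>\<^sub>0 \<in> W" using assms by (auto simp: W_def)
  ultimately have "emeasure lborel W \<noteq> 0"
    using emeasure_lebesgue_open_neq_0[of W] by auto
  moreover have "emeasure lborel W \<le> emeasure lborel (ball 0 1 \<inter> ?f -` U)"
    by (rule emeasure_mono) (use V in \<open>auto simp: W_def U_def\<close>)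
  ultimately have "emeasure lborel (ball 0 1 \<inter> ?f -` U) \<noteq> 0" by auto
  with ball show "emeasure sphere_measure U \<noteq> 0"
    unfolding eq by (auto simp: ennreal_divide_eq_0_iff)
qed

section \<open>Gradient of the ball kernel\<close>

text \<open>Quotient rule, arranged as the scalar \<open>- 2 / d2\<close> times a vector that turns
  out to have length 1 when \<open>\<zeta>\<close> is on the sphere.\<close>

lemma GDERIV_ball_ratio:
  fixes y \<zeta> :: "'a::real_inner"
  assumes "y \<noteq> \<zeta>"
  defines "d2 \<equiv> (norm (y - \<zeta>))\<^sup>2"
  shows "GDERIV (\<lambda>y. (1 - (norm y)\<^sup>2) / (norm (y - \<zeta>))\<^sup>2) y :>
    (- 2 / d2) *\<^sub>R (y + ((1 - (norm y)\<^sup>2) / d2) *\<^sub>R (y - \<zeta>))"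
proof -
  have "(y - \<zeta>) \<bullet> (y - \<zeta>) \<noteq> 0" using assms by simp
  then show ?thesis
    unfolding gderiv_def d2_def power2_norm_eq_inner
    by (auto intro!: derivative_eq_intros ext
        simp: inner_add_right inner_diff_right inner_commute divide_simps power2_eq_square)
qed

text \<open>Since \<open>\<zeta>\<close> is a unit vector,
  \<open>2 * (y \<bullet> (y - \<zeta>))\<close> is determined by \<open>norm y\<close> and
  \<open>d2\<close>. Expanding the square of the vector factor and using
  \<open>a * d2 = 1 - (norm y)\<^sup>2\<close> leaves exactly 1.\<close>

lemma norm_ball_ratio_gradient:
  fixes y \<zeta> :: "'a::real_inner"
  assumes "y \<noteq> \<zeta>" "norm \<zeta> = 1"
  defines "d2 \<equiv> (norm (y - \<zeta>))\<^sup>2"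
  shows "norm ((- 2 / d2) *\<^sub>R (y + ((1 - (norm y)\<^sup>2) / d2) *\<^sub>R (y - \<zeta>))) = 2 / d2"
proof -
  have d2: "d2 > 0" using assms by simp
  have \<zeta>: "\<zeta> \<bullet> \<zeta> = 1" using assms(2) by (simp add: norm_eq_1)
  have yz: "2 * (y \<bullet> (y - \<zeta>)) = (norm y)\<^sup>2 - 1 + d2"
    unfolding d2_def power2_norm_eq_inner using \<zeta> by (simp add: algebra_simps inner_commute)
  define a where "a = (1 - (norm y)\<^sup>2) / d2"
  have "(norm (y + a *\<^sub>R (y - \<zeta>)))\<^sup>2 = (norm y)\<^sup>2 + a * (2 * (y \<bullet> (y - \<zeta>))) + a * a * d2"
    unfolding d2_def power2_norm_eq_inner by (simp add: algebra_simps inner_commute)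
  also have "\<dots> = 1"
  proof -
    have "a * d2 = 1 - (norm y)\<^sup>2" using d2 by (simp add: a_def)
    then show ?thesis unfolding yz by algebra
  qed
  finally have "norm (y + a *\<^sub>R (y - \<zeta>)) = 1"
    by (metis norm_ge_zero power2_eq_1_iff real_sqrt_abs abs_norm_cancel norm_minus_cancel
        abs_of_nonneg real_sqrt_one)
  then show ?thesis using d2 by (simp add: a_def)
qed

definition ball_kernel_grad :: "nat \<Rightarrow> 'a::real_inner \<Rightarrow> 'a \<Rightarrow> 'a" where
  "ball_kernel_grad k y \<zeta> =
    (real k * ((1 - (norm y)\<^sup>2) / (norm (y - \<zeta>))\<^sup>2) ^ (k - 1)) *\<^sub>R
    ((- 2 / (norm (y - \<zeta>))\<^sup>2) *\<^sub>R (y + ((1 - (norm y)\<^sup>2) / (norm (y - \<zeta>))\<^sup>2) *\<^sub>R (y - \<zeta>)))"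

lemma GDERIV_ball_kernel:
  assumes "y \<noteq> \<zeta>"
  shows "GDERIV (\<lambda>y. ((1 - (norm y)\<^sup>2) / (norm (y - \<zeta>))\<^sup>2) ^ k) y :> ball_kernel_grad k y \<zeta>"
  using GDERIV_const_power[OF GDERIV_ball_ratio[OF assms], of 1 k] by (simp add: ball_kernel_grad_def)

lemma one_minus_norm_le_dist_sphere:
  assumes "norm \<zeta> = 1" "norm y < 1"
  shows "(1 - norm y)\<^sup>2 \<le> (norm (y - \<zeta>))\<^sup>2"
  using norm_triangle_ineq2[of \<zeta> y] assms by (intro power_mono) (auto simp: norm_minus_commute)

text \<open>The chain rule multiplies the length \<open>2 / d2\<close> by the derivative of the
  power. The point \<open>\<zeta>\<close> enters only through its distance to \<open>y\<close>, so
  maximizing over the sphere means minimizing that distance.\<close>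

lemma norm_ball_kernel_grad:
  assumes "norm \<zeta> = 1" "norm y < 1" "k \<ge> 1"
  shows "norm (ball_kernel_grad k y \<zeta>) =
    2 * real k * (1 - (norm y)\<^sup>2) ^ (k - 1) / ((norm (y - \<zeta>))\<^sup>2) ^ k"
proof -
  obtain j where k: "k = Suc j" using assms(3) by (cases k) auto
  have "y \<noteq> \<zeta>" using assms by auto
  moreover have "(norm y)\<^sup>2 < 1" using assms(2) by (simp add: power_less_one_iff abs_square_less_1)
  ultimately show ?thesis
    unfolding ball_kernel_grad_def norm_scaleR[of "real k * _"] norm_ball_ratio_gradient[OF \<open>y \<noteq> \<zeta>\<close> assms(1)]
    by (simp add: k abs_mult power_abs[symmetric] power_divide) (simp add: field_simps)
qed

lemma norm_ball_kernel_grad_le: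
  assumes "norm \<zeta> = 1" "norm y < 1" "k \<ge> 1"
  shows "norm (ball_kernel_grad k y \<zeta>) \<le>
    2 * real k * (1 - (norm y)\<^sup>2) ^ (k - 1) / ((1 - norm y)\<^sup>2) ^ k"
  unfolding norm_ball_kernel_grad[OF assms]
  using assms one_minus_norm_le_dist_sphere[OF assms(1,2)]
  by (intro divide_left_mono mult_nonneg_nonneg power_mono zero_le_power mult_pos_pos zero_less_power)
    (auto simp: abs_square_le_1)

text \<open>At the nearest boundary point every vector involved is a multiple of \<open>x\<close>,
  so the upper bound is attained and the direction is radial.\<close>

lemma ball_kernel_grad_extremal:
  assumes "x \<noteq> 0" "norm x < 1" "k \<ge> 1"
  shows "ball_kernel_grad k x (x /\<^sub>R norm x) =
    (2 * real k * (1 - (norm x)\<^sup>2) ^ (k - 1) / ((1 - norm x)\<^sup>2) ^ k) *\<^sub>R (x /\<^sub>R norm x)"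
proof -
  define e \<rho> where "e = x /\<^sub>R norm x" and "\<rho> = norm x"
  have x: "x = \<rho> *\<^sub>R e" and e: "norm e = 1" and \<rho>: "0 < \<rho>" "\<rho> < 1"
    using assms by (auto simp: e_def \<rho>_def)
  obtain j where k: "k = Suc j" using assms(3) by (cases k) auto
  have xe: "x - e = (\<rho> - 1) *\<^sub>R e" by (simp add: x algebra_simps)
  have d: "(norm (x - e))\<^sup>2 = (1 - \<rho>)\<^sup>2" by (simp add: xe e power2_commute)
  \<comment> \<open>The vector factor of length 1 collapses to \<open>- e\<close>, whose sign
    cancels that of \<open>- 2 / d2\<close>.\<close>
  have "\<rho> + (1 - \<rho>\<^sup>2) / (1 - \<rho>)\<^sup>2 * (\<rho> - 1) = - 1"
  proof -
    have "(1 - \<rho>\<^sup>2) / (1 - \<rho>)\<^sup>2 = (1 + \<rho>) / (1 - \<rho>)"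
      using \<rho> by (simp add: divide_eq_eq eq_divide_eq) (simp add: algebra_simps power2_eq_square)
    moreover have "(1 + \<rho>) / (1 - \<rho>) * (\<rho> - 1) = - (1 + \<rho>)"
      using \<rho> by (simp add: divide_eq_eq) (simp add: algebra_simps)
    ultimately show ?thesis by simp
  qed
  then have dir: "x + ((1 - \<rho>\<^sup>2) / (1 - \<rho>)\<^sup>2) *\<^sub>R (x - e) = - e"
    unfolding xe by (simp add: x flip: scaleR_add_left)
  have "ball_kernel_grad k x e =
      (real k * ((1 - \<rho>\<^sup>2) / (1 - \<rho>)\<^sup>2) ^ (k - 1) * (2 / (1 - \<rho>)\<^sup>2)) *\<^sub>R e"
    unfolding ball_kernel_grad_def d \<rho>_def[symmetric] dir by simp
  also have "real k * ((1 - \<rho>\<^sup>2) / (1 - \<rho>)\<^sup>2) ^ (k - 1) * (2 / (1 - \<rho>)\<^sup>2) =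
      2 * real k * (1 - \<rho>\<^sup>2) ^ (k - 1) / ((1 - \<rho>)\<^sup>2) ^ k"
    by (simp add: k power_divide) (simp add: field_simps)
  finally show ?thesis unfolding e_def \<rho>_def .
qed

lemma isCont_ball_kernel_grad:
  assumes "x \<noteq> \<zeta>"
  shows "isCont (ball_kernel_grad k x) \<zeta>"
  unfolding ball_kernel_grad_def[abs_def] using assms by (intro continuous_intros) auto

lemma borel_measurable_ball_kernel_grad:
  "ball_kernel_grad k (x::'a::euclidean_space) \<in> borel_measurable borel"
  unfolding ball_kernel_grad_def[abs_def] by measurable

lemma borel_measurable_sphere_measure:
  "f \<in> borel_measurable borel \<Longrightarrow> f \<in> borel_measurable sphere_measure"
  unfolding sphere_measure_def by (intro measurable_restrict_space1) simp

lemma space_sphere_measure: "space sphere_measure = sphere 0 1"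
  by (simp add: sphere_measure_def space_restrict_space)

lemma gradient_kernel_ball:
  fixes x :: "real^'n"
  assumes x: "x \<noteq> 0" "norm x < 1" and n: "CARD('n) = n" "n \<ge> 2"
  shows "gradient_kernel sphere_measure poisson_ball x (ball_kernel_grad (n - 1) x)
    (2 * (real n - 1) * ((1 + norm x) ^ (n - 2) / (1 - norm x) ^ n)) (x /\<^sub>R norm x)"
proof
  define k where "k = n - 1"
  have k: "k \<ge> 1" using n by (simp add: k_def)
  define A where "A = 2 * real k * (1 - (norm x)\<^sup>2) ^ (k - 1) / ((1 - norm x)\<^sup>2) ^ k"
  \<comment> \<open>Factor \<open>1 - (norm x)\<^sup>2\<close> as
    \<open>(1 - norm x) * (1 + norm x)\<close> and cancel \<open>n - 2\<close> powers of
    \<open>1 - norm x\<close> against the \<open>2 * (n - 1)\<close> in the denominator.\<close>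
  have A: "2 * (real n - 1) * ((1 + norm x) ^ (n - 2) / (1 - norm x) ^ n) = A"
  proof -
    obtain j where j: "n = j + 2" using n(2) by (metis le_iff_add add.commute)
    have "1 - (norm x)\<^sup>2 = (1 - norm x) * (1 + norm x)" by (simp add: algebra_simps power2_eq_square)
    then show ?thesis using x(2)
      by (simp add: A_def k_def j power_mult_distrib divide_simps power2_eq_square)
  qed
  \<comment> \<open>Half the distance to the sphere: points of \<open>ball x r\<close> stay at least
    \<open>r\<close> away from it, which bounds kernel and gradient uniformly.\<close>
  define r where "r = (1 - norm x) / 2"
  have r: "r > 0" using x by (simp add: r_def)
  have in_ball: "norm y < 1" "r \<le> 1 - norm y" if "y \<in> ball x r" for y
  proof -
    have "norm y \<le> norm x + norm (y - x)" by (metis norm_triangle_sub)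
    moreover have "norm (y - x) < r" using that by (simp add: dist_norm norm_minus_commute)
    ultimately show "r \<le> 1 - norm y" by (simp add: r_def field_simps)
    with r show "norm y < 1" by linarith
  qed
  show "norm (x /\<^sub>R norm x) = 1" using x by simp
  show "ball_kernel_grad (n - 1) x \<in> borel_measurable sphere_measure"
    by (intro borel_measurable_sphere_measure borel_measurable_ball_kernel_grad)
  show "norm (ball_kernel_grad (n - 1) x \<zeta>) \<le>
      2 * (real n - 1) * ((1 + norm x) ^ (n - 2) / (1 - norm x) ^ n)"
    if "\<zeta> \<in> space sphere_measure" for \<zeta>
    unfolding A A_def k_def[symmetric]
    using norm_ball_kernel_grad_le[of \<zeta> x k] that x k by (simp add: space_sphere_measure)
  show "\<exists>U\<in>sets sphere_measure. emeasure sphere_measure U \<noteq> 0 \<and> emeasure sphere_measure U \<noteq> \<infinity> \<and>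
      (\<forall>\<zeta>\<in>U. norm (ball_kernel_grad (n - 1) x \<zeta> -
        (2 * (real n - 1) * ((1 + norm x) ^ (n - 2) / (1 - norm x) ^ n)) *\<^sub>R (x /\<^sub>R norm x)) \<le> \<epsilon>)"
    if "\<epsilon> > 0" for \<epsilon>
  proof -
    let ?e = "x /\<^sub>R norm x"
    \<comment> \<open>The kernel gradient is singular only at \<open>\<zeta> = x\<close>, so it is
      continuous at \<open>?e\<close> and stays near its extremal value on a small cap.\<close>
    have "x \<noteq> ?e" using x by (metis \<open>norm ?e = 1\<close> less_irrefl)
    then obtain \<delta> where "\<delta> > 0"
      and \<delta>: "\<And>\<zeta>. dist \<zeta> ?e < \<delta> \<Longrightarrow> dist (ball_kernel_grad k x \<zeta>) (ball_kernel_grad k x ?e) < \<epsilon>"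
      using isCont_ball_kernel_grad \<open>\<epsilon> > 0\<close> unfolding continuous_at_eps_delta by meson
    have "?e \<in> sphere 0 1" using x by simp
    note cap = sphere_measure_cap[OF this \<open>\<delta> > 0\<close>]
    show ?thesis
      unfolding A k_def[symmetric] A_def ball_kernel_grad_extremal[OF x k, symmetric]
      by (rule bexI[OF _ cap(1)])
        (use cap(2,3) \<delta> in \<open>auto simp: dist_commute simp flip: dist_norm intro: less_imp_le\<close>)
  qed
  show "GDERIV (poisson_ball \<phi>) x :> (LINT \<zeta>|sphere_measure. \<phi> \<zeta> *\<^sub>R ball_kernel_grad (n - 1) x \<zeta>)"
    if "integrable sphere_measure \<phi>" for \<phi>
    unfolding poisson_ball_def[abs_def] n(1) k_def[symmetric]
  proof (rule GDERIV_integral[OF r _ _ _ _ _ that])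
    fix y \<zeta> :: "real^'n" assume "y \<in> ball x r" and "\<zeta> \<in> space sphere_measure"
    then have y: "norm y < 1" "r \<le> 1 - norm y" and \<zeta>: "norm \<zeta> = 1"
      using in_ball by (auto simp: space_sphere_measure)
    show "GDERIV (\<lambda>y. ((1 - (norm y)\<^sup>2) / (norm (y - \<zeta>))\<^sup>2) ^ k) y :> ball_kernel_grad k y \<zeta>"
      using y \<zeta> by (intro GDERIV_ball_kernel) auto
    have sq: "0 \<le> 1 - (norm y)\<^sup>2" "1 - (norm y)\<^sup>2 \<le> 1" using y by (auto simp: abs_square_le_1)
    have r2: "r\<^sup>2 \<le> (1 - norm y)\<^sup>2" using y r by (intro power_mono) auto
    \<comment> \<open>Uniform in \<open>y\<close>: the numerator power is at most 1 and the squared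
      distance to the sphere at least \<open>r\<^sup>2\<close>.\<close>
    have "2 * real k * (1 - (norm y)\<^sup>2) ^ (k - 1) / ((1 - norm y)\<^sup>2) ^ k \<le> 2 * real k * 1 / (r\<^sup>2) ^ k"
      using sq r y(2) by (intro frac_le mult_left_mono power_le_one power_mono) auto
    with norm_ball_kernel_grad_le[OF \<zeta> y(1) k]
    show "norm (ball_kernel_grad k y \<zeta>) \<le> 2 * real k / (r\<^sup>2) ^ k" by simp
    have "(1 - (norm y)\<^sup>2) / (norm (y - \<zeta>))\<^sup>2 \<le> 1 / r\<^sup>2"
      using sq r order_trans[OF r2 one_minus_norm_le_dist_sphere[OF \<zeta> y(1)]] by (intro frac_le) auto
    then show "\<bar>((1 - (norm y)\<^sup>2) / (norm (y - \<zeta>))\<^sup>2) ^ k\<bar> \<le> (1 / r\<^sup>2) ^ k"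
      using sq by (simp add: power_abs[symmetric] power_mono del: power_divide)
  next
    show "(\<lambda>\<zeta>. ((1 - (norm y)\<^sup>2) / (norm (y - \<zeta>))\<^sup>2) ^ k) \<in> borel_measurable sphere_measure"
      for y :: "real^'n"
      by (rule borel_measurable_sphere_measure) measurable
  qed (intro borel_measurable_sphere_measure borel_measurable_ball_kernel_grad)
qed

section \<open>The half-space\<close>

lemma GDERIV_half_space_ratio:
  fixes x :: "'a::real_inner \<times> real" and y :: 'a
  assumes "snd x > 0"
  defines "D \<equiv> (norm (fst x - y))\<^sup>2 + (snd x)\<^sup>2"
  shows "GDERIV (\<lambda>x. snd x / ((norm (fst x - y))\<^sup>2 + (snd x)\<^sup>2)) x :>
    (- 2 * snd x / D\<^sup>2) *\<^sub>R (fst x - y, snd x) + (0, 1 / D)"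
proof -
  have "(fst x - y) \<bullet> (fst x - y) + (snd x)\<^sup>2 \<noteq> 0"
    using assms(1) inner_ge_zero[of "fst x - y"] by (smt (verit) zero_less_power)
  then show ?thesis
    unfolding gderiv_def D_def power2_norm_eq_inner
    by (auto intro!: derivative_eq_intros ext
        simp: inner_prod_def inner_add_right inner_diff_right inner_commute divide_simps power2_eq_square)
      (auto simp: algebra_simps inner_commute)
qed

text \<open>With \<open>b = - 2 * t / D\<^sup>2\<close> the terms \<open>b\<^sup>2 * D\<close> and
  \<open>2 * b * t / D\<close> of the squared length cancel, leaving
  \<open>1 / D\<^sup>2\<close>.\<close>

lemma norm_half_space_ratio_gradient:
  fixes x :: "'a::real_inner \<times> real" and y :: 'a
  assumes "snd x > 0"
  defines "D \<equiv> (norm (fst x - y))\<^sup>2 + (snd x)\<^sup>2"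
  shows "norm ((- 2 * snd x / D\<^sup>2) *\<^sub>R (fst x - y, snd x) + (0, 1 / D)) = 1 / D"
proof -
  have D: "D > 0" using assms(1) by (simp add: D_def add_nonneg_pos)
  define t where "t = snd x"
  define b where "b = - 2 * t / D\<^sup>2"
  have "(norm (b *\<^sub>R (fst x - y, t) + (0, 1 / D)))\<^sup>2 = b\<^sup>2 * D + 2 * b * t / D + 1 / D\<^sup>2"
    unfolding power2_norm_eq_inner D_def t_def
    by (simp add: inner_prod_def power2_eq_square algebra_simps add_divide_distrib)
  also have "\<dots> = (1 / D)\<^sup>2"
    using D by (simp add: b_def field_simps power2_eq_square)
  finally have "norm (b *\<^sub>R (fst x - y, t) + (0, 1 / D)) = 1 / D"
    using D by (simp add: power2_eq_iff_nonneg)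
  then show ?thesis by (simp add: b_def t_def)
qed

text \<open>The normalizing factor \<open>c\<close> is taken into the kernel, so that the gradient
  of the integral carries no extra scalar.\<close>

definition half_space_kernel_grad ::
    "real \<Rightarrow> nat \<Rightarrow> 'a::real_inner \<times> real \<Rightarrow> 'a \<Rightarrow> 'a \<times> real" where
  "half_space_kernel_grad c k x y =
    (let D = (norm (fst x - y))\<^sup>2 + (snd x)\<^sup>2 in
      (c * (real k * (snd x / D) ^ (k - 1))) *\<^sub>R
      ((- 2 * snd x / D\<^sup>2) *\<^sub>R (fst x - y, snd x) + (0, 1 / D)))"

lemma GDERIV_half_space_kernel:
  assumes "snd x > 0"
  shows "GDERIV (\<lambda>x. c * (snd x / ((norm (fst x - y))\<^sup>2 + (snd x)\<^sup>2)) ^ k) x :>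
    half_space_kernel_grad c k x y"
  unfolding half_space_kernel_grad_def Let_def
  by (rule GDERIV_const_power[OF GDERIV_half_space_ratio[OF assms]])

text \<open>The length is a decreasing function of \<open>D\<close>, and \<open>D\<close> is at
  least \<open>t\<^sup>2\<close>, with equality at the foot point \<open>y = fst x\<close>.\<close>

lemma norm_half_space_kernel_grad_le:
  assumes "snd x > 0" "c \<ge> 0" "k \<ge> 1"
  shows "norm (half_space_kernel_grad c k x y) \<le> c * real k / snd x ^ (k + 1)"
proof -
  obtain j where k: "k = Suc j" using assms(3) by (cases k) auto
  define t D where "t = snd x" and "D = (norm (fst x - y))\<^sup>2 + t\<^sup>2"
  have t: "t > 0" and D: "t\<^sup>2 \<le> D" "D > 0"
    using assms(1) by (auto simp: t_def D_def add_nonneg_pos)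
  have "norm (half_space_kernel_grad c k x y) = c * real k * (t / D) ^ j * (1 / D)"
    unfolding half_space_kernel_grad_def Let_def norm_scaleR[of "c * _"]
      norm_half_space_ratio_gradient[OF assms(1)]
    using t D assms(2) by (simp add: k D_def t_def abs_mult)
  also have "\<dots> \<le> c * real k * (t / t\<^sup>2) ^ j * (1 / t\<^sup>2)"
    using t D assms(2) by (intro mult_mono power_mono mult_nonneg_nonneg frac_le) auto
  also have "\<dots> = c * real k / t ^ (k + 1)"
    using t by (simp add: k power2_eq_square power_divide)
  finally show ?thesis by (simp add: t_def)
qed

text \<open>Here \<open>D\<close> is \<open>(snd x)\<^sup>2\<close>, and the two vertical terms add
  up to \<open>- 1 / D\<close>. The extremal vector thus points down, towards the boundary.\<close>

lemma half_space_kernel_grad_extremal: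
  assumes "snd x > 0" "k \<ge> 1"
  shows "half_space_kernel_grad c k x (fst x) = (c * real k / snd x ^ (k + 1)) *\<^sub>R (0, - 1)"
proof -
  obtain j where k: "k = Suc j" using assms(2) by (cases k) auto
  show ?thesis using assms(1)
    by (simp add: half_space_kernel_grad_def k power2_eq_square power_divide field_simps zero_prod_def)
qed

lemma isCont_half_space_kernel_grad:
  assumes "snd x > 0"
  shows "isCont (half_space_kernel_grad c k x) y"
proof -
  have "(norm (fst x - y))\<^sup>2 + (snd x)\<^sup>2 \<noteq> 0" using assms by (simp add: sum_power2_eq_zero_iff)
  then show ?thesis
    unfolding half_space_kernel_grad_def[abs_def] Let_def by (intro continuous_intros) auto
qed

lemma half_space_const_pos: "n > 0 \<Longrightarrow> half_space_const n > 0"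
  by (simp add: half_space_const_def Gamma_real_pos)

lemma gradient_kernel_half_space:
  fixes x :: "(real^'m) \<times> real"
  assumes x: "snd x > 0"
  defines "k \<equiv> CARD('m)" and "c \<equiv> half_space_const (CARD('m) + 1)"
  shows "gradient_kernel lebesgue poisson_half_space x (half_space_kernel_grad c k x)
    (c * real k / snd x ^ (k + 1)) (0, - 1)"
proof
  have k: "k \<ge> 1" by (simp add: k_def Suc_leI)
  have c: "c > 0" by (simp add: c_def half_space_const_pos)
  \<comment> \<open>Half the height of \<open>x\<close>, so that all points of
    \<open>ball x r\<close> have height at least \<open>r\<close>.\<close>
  define r where "r = snd x / 2"
  have r: "r > 0" using x by (simp add: r_def)
  have in_ball: "r \<le> snd y" if "y \<in> ball x r" for y
    using that dist_snd_le[of x y] by (auto simp: r_def dist_real_def)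
  \<comment> \<open>As \<open>x\<close> is off the boundary, the kernel gradient is continuous on
    all of it, hence Borel and then Lebesgue measurable.\<close>
  have "half_space_kernel_grad c k x \<in> borel_measurable borel"
    by (intro borel_measurable_continuous_onI)
      (simp add: continuous_on_eq_continuous_at isCont_half_space_kernel_grad x)
  then have meas_grad: "half_space_kernel_grad c k x \<in> borel_measurable lebesgue"
    by (intro measurable_completion) simp
  then show "half_space_kernel_grad c k x \<in> borel_measurable lebesgue" .
  show "norm ((0, - 1) :: (real^'m) \<times> real) = 1" by (simp add: norm_Pair)
  show "norm (half_space_kernel_grad c k x y) \<le> c * real k / snd x ^ (k + 1)" for y
    using norm_half_space_kernel_grad_le[OF x _ k] c by simp
  show "\<exists>U\<in>sets lebesgue. emeasure lebesgue U \<noteq> 0 \<and> emeasure lebesgue U \<noteq> \<infinity> \<and>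
      (\<forall>y\<in>U. norm (half_space_kernel_grad c k x y - (c * real k / snd x ^ (k + 1)) *\<^sub>R (0, - 1)) \<le> \<epsilon>)"
    if "\<epsilon> > 0" for \<epsilon>
  proof -
    obtain \<delta> where "\<delta> > 0" and \<delta>: "\<And>y. dist y (fst x) < \<delta> \<Longrightarrow>
        dist (half_space_kernel_grad c k x y) (half_space_kernel_grad c k x (fst x)) < \<epsilon>"
      using isCont_half_space_kernel_grad[OF x] \<open>\<epsilon> > 0\<close> unfolding continuous_at_eps_delta by meson
    have "emeasure lebesgue (ball (fst x) \<delta>) \<noteq> 0"
      using \<open>\<delta> > 0\<close> by (intro emeasure_lebesgue_open_neq_0) auto
    moreover have "emeasure lebesgue (ball (fst x) \<delta>) \<noteq> \<infinity>"
      using emeasure_bounded_finite[of "ball (fst x) \<delta>"] by auto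
    ultimately show ?thesis
      unfolding half_space_kernel_grad_extremal[OF x k, symmetric]
      by (intro bexI[of _ "ball (fst x) \<delta>"])
        (use \<delta> in \<open>auto simp: dist_commute simp flip: dist_norm intro: less_imp_le\<close>)
  qed
  show "GDERIV (poisson_half_space \<phi>) x :> (LINT y|lebesgue. \<phi> y *\<^sub>R half_space_kernel_grad c k x y)"
    if "integrable lebesgue \<phi>" for \<phi>
  proof -
    have P: "poisson_half_space \<phi> =
        (\<lambda>x. LINT y|lebesgue. c * (snd x / ((norm (fst x - y))\<^sup>2 + (snd x)\<^sup>2)) ^ k * \<phi> y)"
      by (simp add: fun_eq_iff poisson_half_space_def c_def k_def mult.assoc)
    show ?thesis
      unfolding P
    proof (rule GDERIV_integral[where G="half_space_kernel_grad c k", OF r _ _ _ _ meas_grad that])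
      fix z y assume "z \<in> ball x r"
      from in_ball[OF this] r have z: "snd z > 0" "r \<le> snd z" by auto
      show "GDERIV (\<lambda>x. c * (snd x / ((norm (fst x - y))\<^sup>2 + (snd x)\<^sup>2)) ^ k) z :>
          half_space_kernel_grad c k z y"
        by (rule GDERIV_half_space_kernel[OF z(1)])
      have "c * real k / snd z ^ (k + 1) \<le> c * real k / r ^ (k + 1)"
        using z r c by (intro divide_left_mono mult_pos_pos power_mono zero_less_power) auto
      with norm_half_space_kernel_grad_le[OF z(1) _ k, of c y] c
      show "norm (half_space_kernel_grad c k z y) \<le> c * real k / r ^ (k + 1)" by simp
      let ?q = "snd z / ((norm (fst z - y))\<^sup>2 + (snd z)\<^sup>2)"
      \<comment> \<open>Dropping the horizontal distance bounds the ratio by the inverse height,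
        hence by \<open>1 / r\<close>.\<close>
      have "?q \<le> snd z / (snd z)\<^sup>2"
        using z by (intro divide_left_mono mult_pos_pos) (auto simp: add_nonneg_pos)
      also have "\<dots> \<le> 1 / r" using z r by (simp add: power2_eq_square frac_le)
      finally have "?q ^ k \<le> (1 / r) ^ k" using z by (intro power_mono) auto
      then show "\<bar>c * ?q ^ k\<bar> \<le> c * (1 / r) ^ k"
        using c z by (simp add: abs_mult del: power_divide)
    next
      show "(\<lambda>y. c * (snd z / ((norm (fst z - y))\<^sup>2 + (snd z)\<^sup>2)) ^ k) \<in> borel_measurable lebesgue"
        for z :: "(real^'m) \<times> real"
        by (intro measurable_completion) measurable
    qed
  qed
qed

theorem theorem1p6:
  fixes n :: nat
  assumes "n \<ge> 3" and "CARD('n::finite) = n" and "CARD('m::finite) + 1 = n"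
  shows "(\<forall>x \<in> ball (0 :: real^'n) 1 - {0}. \<forall>l \<in> sphere 0 1. \<forall>s \<in> {1, - 1}.
            C_ball_dir x l \<le> C_ball_dir x (s *\<^sub>R (x /\<^sub>R norm x)) \<and>
            C_ball_dir x (s *\<^sub>R (x /\<^sub>R norm x)) = C_ball x \<and>
            C_ball x = 2 * (real n - 1) * ((1 + norm x) ^ (n - 2) / (1 - norm x) ^ n)) \<and>
         (\<forall>x \<in> (half_space :: ((real^'m) \<times> real) set). \<forall>l \<in> sphere 0 1. \<forall>s \<in> {1, - 1}.
            C_half_space_dir x l \<le> C_half_space_dir x (s *\<^sub>R (0, 1)) \<and>
            C_half_space_dir x (s *\<^sub>R (0, 1)) = C_half_space x \<and>
            C_half_space x =
              2 ^ (n - 2) * (real n - 1) * Gamma (real n / 2) / (pi powr (real n / 2) * snd x ^ n))"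
proof (intro conjI[of "Ball _ _"] ballI)
  fix x l :: "real^'n" and s :: real
  assume "x \<in> ball 0 1 - {0}" "l \<in> sphere 0 1" "s \<in> {1, - 1}"
  then show "C_ball_dir x l \<le> C_ball_dir x (s *\<^sub>R (x /\<^sub>R norm x)) \<and>
      C_ball_dir x (s *\<^sub>R (x /\<^sub>R norm x)) = C_ball x \<and>
      C_ball x = 2 * (real n - 1) * ((1 + norm x) ^ (n - 2) / (1 - norm x) ^ n)"
    using assms(1,2) by (intro gradient_kernel.extremal[OF gradient_kernel_ball]) auto
next
  fix x l :: "(real^'m) \<times> real" and s :: real
  assume "x \<in> half_space" and l: "l \<in> sphere 0 1" and s: "s \<in> {1, - 1}"
  then have "snd x > 0" by (simp add: half_space_def)
  \<comment> \<open>The extremal vector is \<open>(0, - 1)\<close>, so the sign \<open>- s\<close>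
    produces the direction \<open>s *\<^sub>R (0, 1)\<close>.\<close>
  from gradient_kernel.extremal[OF gradient_kernel_half_space[OF this], of l "- s"]
  have "C_half_space_dir x l \<le> C_half_space_dir x (- s *\<^sub>R (0, - 1)) \<and>
      C_half_space_dir x (- s *\<^sub>R (0, - 1)) = C_half_space x \<and>
      C_half_space x = half_space_const n * real CARD('m) / snd x ^ n"
    using l s assms(3) by auto
  moreover have "- s *\<^sub>R (0, - 1) = s *\<^sub>R ((0, 1) :: (real^'m) \<times> real)" by simp
  moreover have "real CARD('m) = real n - 1" using assms(3) by linarith
  ultimately show "C_half_space_dir x l \<le> C_half_space_dir x (s *\<^sub>R (0, 1)) \<and>
      C_half_space_dir x (s *\<^sub>R (0, 1)) = C_half_space x \<and>
      C_half_space x =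
        2 ^ (n - 2) * (real n - 1) * Gamma (real n / 2) / (pi powr (real n / 2) * snd x ^ n)"
    by (simp add: half_space_const_def mult_ac)
qed

end
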